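(* Let $k\ge2$, let $\alpha$ be a simple ordered rational $k$-cone in $\mathbb{R}^n$, and let $s\in S_k$ be a transposition. Then $$\operatorname{lsin}_k\alpha=\operatorname{lsin}_k\alpha_s .$$
   Context: An ordered rational $k$-cone $\alpha$ in $\mathbb{R}^n$ ($k\le n$) is given by a vertex $A_0\in\mathbb{Z}^n$ and an ordered tuple $(v_1,\ldots,v_k)$ of linearly independent primitive integer vectors (its edge vectors); as a set it is $\{A_0+\sum\lambda_iv_i:\lambda_i\ge0\}$. Let $\Gamma=\mathbb{Z}^n\cap\operatorname{span}_{\mathbb{R}}(v_1,\ldots,v_k)$. There is a unique $\mathbb{Z}$-basis $e_1,\ldots,e_k$ of $\Gamma$ such that $v_i=\sum_{j\le i}a_{j,i}e_j$ with $a_{i,i}>0$ and $0\le a_{j,i}<a_{i,i}$ for $j<i$. The $i$-th integer sine is $\operatorname{lsin}_i\alpha=a_{i,i}$. The integer sine of a rational $m$-cone $\beta$ with primitive edge vectors $w_1,\ldots,w_m$ is the index $\operatorname{lsin}(\beta)=[\mathbb{Z}^n\cap\operatorname{span}_{\mathbb{R}}(w_1,\ldots,w_m):\mathbb{Z}w_1+\cdots+\mathbb{Z}w_m]$. The cone $\alpha$ is simple if every $(k-1)$-dimensional face $\beta$ of $\alpha$ (the cone with vertex $A_0$ generated by $k-1$ of the vectors $v_i$) satisfies $\operatorname{lsin}(\beta)=1$. For $s\in S_k$, $\alpha_s$ denotes the $s$-transpose of $\alpha$: the cone with the same vertex and with ordered edge vectors $(v_{s(1)},\ldots,v_{s(k)})$.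 *)

theory Defs
  imports "HOL-Analysis.Analysis" "HOL-Algebra.Coset"
begin

record 'n ordered_cone =
  vertex :: "int ^ 'n"
  edges :: "(int ^ 'n) list"

text \<open>Edge vectors are numbered from 1, so that \<open>edge \<alpha> i\<close> is \<open>v\<^sub>i\<close>.\<close>

definition edge :: "'n::finite ordered_cone \<Rightarrow> nat \<Rightarrow> int ^ 'n" where
  "edge \<alpha> i = edges \<alpha> ! (i - 1)"

definition real_vec :: "int ^ 'n \<Rightarrow> real ^ 'n" where
  "real_vec x = (\<chi> i. real_of_int (x $ i))"

definition primitive :: "int ^ 'n \<Rightarrow> bool" where
  "primitive x \<longleftrightarrow> Gcd (range (\<lambda>i. x $ i)) = 1"

definition rational_cone :: "nat \<Rightarrow> 'n::finite ordered_cone \<Rightarrow> bool" where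
  "rational_cone k \<alpha> \<longleftrightarrow>
     length (edges \<alpha>) = k \<and>
     (\<forall>v \<in> set (edges \<alpha>). primitive v) \<and>
     distinct (edges \<alpha>) \<and> independent (real_vec ` set (edges \<alpha>))"

definition cone_set :: "'n::finite ordered_cone \<Rightarrow> (real ^ 'n) set" where
  "cone_set \<alpha> = {real_vec (vertex \<alpha>) + (\<Sum>v \<in> set (edges \<alpha>). c v *\<^sub>R real_vec v) | c.
     \<forall>v \<in> set (edges \<alpha>). c v \<ge> 0}"

text \<open>The lattice \<open>\<Gamma>\<close> of integer points in the real linear span of the edge vectors.\<close>

definition span_lattice :: "'n::finite ordered_cone \<Rightarrow> (int ^ 'n) set" where
  "span_lattice \<alpha> = {x. real_vec x \<in> span (real_vec ` set (edges \<alpha>))}"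

definition edge_lattice :: "'n::finite ordered_cone \<Rightarrow> (int ^ 'n) set" where
  "edge_lattice \<alpha> = {\<Sum>v \<in> set (edges \<alpha>). c v *s v | c. True}"

text \<open>The index of \<open>edge_lattice \<alpha>\<close> in \<open>span_lattice \<alpha>\<close>. It does not depend on the order
  of the edge vectors.\<close>

definition integer_sine :: "'n::finite ordered_cone \<Rightarrow> nat" where
  "integer_sine \<alpha> =
     card (rcosets\<^bsub>\<lparr>carrier = span_lattice \<alpha>, monoid.mult = (+), one = 0\<rparr>\<^esub> edge_lattice \<alpha>)"

definition facets :: "'n::finite ordered_cone \<Rightarrow> 'n ordered_cone set" where
  "facets \<alpha> = {\<lparr>vertex = vertex \<alpha>, edges = nths (edges \<alpha>) J\<rparr> | J.
     J \<subseteq> {..<length (edges \<alpha>)} \<and> card J = length (edges \<alpha>) - 1}"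

definition simple_cone :: "'n::finite ordered_cone \<Rightarrow> bool" where
  "simple_cone \<alpha> \<longleftrightarrow> (\<forall>\<beta> \<in> facets \<alpha>. integer_sine \<beta> = 1)"

definition is_int_basis :: "nat \<Rightarrow> (nat \<Rightarrow> int ^ 'n::finite) \<Rightarrow> (int ^ 'n) set \<Rightarrow> bool" where
  "is_int_basis k e \<Gamma> \<longleftrightarrow>
     \<Gamma> = {\<Sum>j = 1..k. c j *s e j | c. True} \<and>
     (\<forall>c. (\<Sum>j = 1..k. c j *s e j) = 0 \<longrightarrow> (\<forall>j \<in> {1..k}. c j = 0))"

definition hermite_basis ::
  "'n::finite ordered_cone \<Rightarrow> (nat \<Rightarrow> int ^ 'n) \<Rightarrow> (nat \<Rightarrow> nat \<Rightarrow> int) \<Rightarrow> bool" where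
  "hermite_basis \<alpha> e a \<longleftrightarrow> (let k = length (edges \<alpha>) in
     is_int_basis k e (span_lattice \<alpha>) \<and>
     (\<forall>i \<in> {1..k}. edge \<alpha> i = (\<Sum>j = 1..i. a j i *s e j) \<and> a i i > 0 \<and>
        (\<forall>j \<in> {1..<i}. 0 \<le> a j i \<and> a j i < a i i)))"

text \<open>For a rational cone the basis \<open>e\<close> is unique on the indices \<open>{1..k}\<close>; its values at other
  indices are irrelevant. Hence the description is applied to \<open>a\<^sub>i\<^sub>i\<close> rather than to \<open>e\<close>.\<close>

definition lsin :: "nat \<Rightarrow> 'n::finite ordered_cone \<Rightarrow> int" where
  "lsin i \<alpha> = (THE d. \<exists>e a. hermite_basis \<alpha> e a \<and> d = a i i)"

definition cone_transpose :: "(nat \<Rightarrow> nat) \<Rightarrow> 'n::finite ordered_cone \<Rightarrow> 'n ordered_cone" where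
  "cone_transpose s \<alpha> =
     \<lparr>vertex = vertex \<alpha>, edges = map (\<lambda>i. edge \<alpha> (s i)) [1..<Suc (length (edges \<alpha>))]\<rparr>"

end

theory Submission
  imports Defs
begin

text \<open>Write \<open>\<Gamma>\<close> for the lattice of integer points in the span of the edge vectors. For a simple
  cone, \<open>v\<^sub>1, \<dots>, v\<^bsub>k-1\<^esub>\<close> already generate all integer points of their span, so any Hermite basis
  starts with \<open>v\<^sub>1, \<dots>, v\<^bsub>k-1\<^esub>\<close> and the quotient of \<open>\<Gamma>\<close> by the edge lattice is cyclic of order
  \<open>a\<^sub>k\<^sub>k\<close>, generated by \<open>e\<^sub>k\<close>. Thus \<open>a\<^sub>k\<^sub>k\<close> is the exponent of that quotient, which does not depend
  on the order of the edge vectors. Existence of the Hermite basis holds because the \<open>k\<close>-th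
  coordinates of the points of \<open>\<Gamma>\<close> form a discrete subgroup of the reals.\<close>

section \<open>Integer vectors as a module over the integers\<close>

interpretation zvec: module "(*s) :: int \<Rightarrow> int ^ 'n::finite \<Rightarrow> int ^ 'n"
  by unfold_locales (auto simp: vec_eq_iff algebra_simps)

text \<open>Taken over a bare set of vectors, so that facets are covered by \<open>V - {w}\<close>
  without constructing a cone.\<close>

definition lattice_points :: "(int ^ 'n::finite) set \<Rightarrow> (int ^ 'n) set" where
  "lattice_points V = {x. real_vec x \<in> span (real_vec ` V)}"

text \<open>Outside the span \<open>representation\<close> is 0 by default, which is why the
  additivity rules assume lattice points.\<close>

definition coord :: "(int ^ 'n::finite) set \<Rightarrow> int ^ 'n \<Rightarrow> int ^ 'n \<Rightarrow> real" where
  "coord V w x = representation (real_vec ` V) (real_vec x) (real_vec w)"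

lemma real_vec_simps [simp]:
  "real_vec 0 = 0"
  "real_vec (x + y) = real_vec x + real_vec y"
  "real_vec (x - y) = real_vec x - real_vec y"
  "real_vec (c *s x) = real_of_int c *\<^sub>R real_vec x"
  by (auto simp: real_vec_def vec_eq_iff)

lemma real_vec_sum: "real_vec (\<Sum>i\<in>I. f i) = (\<Sum>i\<in>I. real_vec (f i))"
  by (induction I rule: infinite_finite_induct) auto

lemma inj_real_vec: "inj real_vec"
  by (auto simp: inj_def real_vec_def vec_eq_iff)

lemma subspace_lattice_points: "zvec.subspace (lattice_points V)"
  by (auto simp: zvec.subspace_def lattice_points_def span_zero span_add span_scale)

lemma lattice_points_superset: "V \<subseteq> lattice_points V"
  by (auto simp: lattice_points_def intro: span_base)

lemma lattice_points_mono: "V \<subseteq> W \<Longrightarrow> lattice_points V \<subseteq> lattice_points W"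
  using span_mono[of "real_vec ` V" "real_vec ` W"] by (auto simp: lattice_points_def)

lemma zspan_subset_lattice_points: "zvec.span V \<subseteq> lattice_points V"
  by (simp add: zvec.span_minimal lattice_points_superset subspace_lattice_points)

lemma edge_lattice_eq: "edge_lattice \<alpha> = zvec.span (set (edges \<alpha>))"
  by (auto simp: edge_lattice_def zvec.span_finite)

lemma span_lattice_eq: "span_lattice \<alpha> = lattice_points (set (edges \<alpha>))"
  by (auto simp: span_lattice_def lattice_points_def)

section \<open>Index one as saturation of facet lattices\<close>

text \<open>If there is a single coset, that of \<open>x\<close> equals that of 0, which is the edge
  lattice itself.\<close>

lemma integer_sine_1D:
  assumes "integer_sine \<beta> = 1"
  shows "lattice_points (set (edges \<beta>)) \<subseteq> zvec.span (set (edges \<beta>))"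
proof
  fix x assume x: "x \<in> lattice_points (set (edges \<beta>))"
  let ?H = "edge_lattice \<beta>"
  let ?G = "\<lparr>carrier = span_lattice \<beta>, monoid.mult = (+), one = 0\<rparr>"
  have coset: "?H #>\<^bsub>?G\<^esub> a = (\<lambda>h. h + a) ` ?H" for a
    by (auto simp: r_coset_def)
  obtain S where S: "rcosets\<^bsub>?G\<^esub> ?H = {S}"
    using assms by (metis integer_sine_def card_1_singletonE)
  have "?H #>\<^bsub>?G\<^esub> a = S" if "a \<in> span_lattice \<beta>" for a
    using S that by (auto simp: RCOSETS_def)
  moreover have "x \<in> span_lattice \<beta>" "0 \<in> span_lattice \<beta>"
    using x by (auto simp: span_lattice_eq subspace_lattice_points zvec.subspace_0)
  ultimately have "(\<lambda>h. h + x) ` ?H = (\<lambda>h. h + 0) ` ?H"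
    unfolding coset by metis
  moreover have "0 + x \<in> (\<lambda>h. h + x) ` ?H"
    by (rule imageI) (simp add: edge_lattice_eq zvec.span_zero)
  ultimately show "x \<in> zvec.span (set (edges \<beta>))"
    by (simp add: edge_lattice_eq)
qed

text \<open>The only form in which simplicity is used. It mentions the set of edge vectors but not
  their order, so it serves a cone and its transpose alike.\<close>

lemma simple_cone_facetD:
  assumes "simple_cone \<alpha>" "distinct (edges \<alpha>)" "w \<in> set (edges \<alpha>)"
  shows "lattice_points (set (edges \<alpha>) - {w}) \<subseteq> zvec.span (set (edges \<alpha>) - {w})"
proof -
  let ?n = "length (edges \<alpha>)"
  obtain i where i: "i < ?n" "edges \<alpha> ! i = w"
    using assms(3) by (auto simp: in_set_conv_nth)
  define J where "J = {..<?n} - {i}"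
  define \<beta> where "\<beta> = \<lparr>vertex = vertex \<alpha>, edges = nths (edges \<alpha>) J\<rparr>"
  have "\<beta> \<in> facets \<alpha>"
    using i(1) by (auto simp: \<beta>_def facets_def J_def intro!: exI[of _ J])
  then have "integer_sine \<beta> = 1"
    using assms(1) by (auto simp: simple_cone_def)
  moreover have "set (edges \<beta>) = set (edges \<alpha>) - {w}"
    using i assms(2)
    by (auto simp: \<beta>_def set_nths J_def in_set_conv_nth nth_eq_iff_index_eq)
  ultimately show ?thesis
    using integer_sine_1D by metis
qed

lemma finite_bounded_int_vec: "finite {x :: int ^ 'n::finite. \<forall>i. \<bar>x $ i\<bar> \<le> M}"
proof (rule finite_subset)
  show "{x :: int ^ 'n. \<forall>i. \<bar>x $ i\<bar> \<le> M} \<subseteq> vec_lambda ` (PiE UNIV (\<lambda>_. {-M..M}))"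
  proof
    fix x :: "int ^ 'n" assume "x \<in> {x. \<forall>i. \<bar>x $ i\<bar> \<le> M}"
    then have "vec_nth x \<in> PiE UNIV (\<lambda>_. {-M..M})"
      by (auto simp: abs_le_iff) (metis minus_le_iff)
    then show "x \<in> vec_lambda ` (PiE UNIV (\<lambda>_. {-M..M}))"
      by (metis image_eqI vec_nth_inverse)
  qed
qed (auto intro!: finite_PiE)

section \<open>Real coordinates of lattice points\<close>

context
  fixes V :: "(int ^ 'n::finite) set"
  assumes indep: "independent (real_vec ` V)"
begin

lemma finite_edges: "finite V"
  using indep inj_real_vec finite_imageD independent_imp_finite
  by (metis inj_on_subset subset_UNIV)

lemma coord_add:
  "\<lbrakk>x \<in> lattice_points V; y \<in> lattice_points V\<rbrakk> \<Longrightarrow> coord V w (x + y) = coord V w x + coord V w y"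
  using indep by (simp add: coord_def lattice_points_def representation_add)

lemma coord_diff:
  "\<lbrakk>x \<in> lattice_points V; y \<in> lattice_points V\<rbrakk> \<Longrightarrow> coord V w (x - y) = coord V w x - coord V w y"
  using indep by (simp add: coord_def lattice_points_def representation_diff)

lemma coord_scale:
  "x \<in> lattice_points V \<Longrightarrow> coord V w (c *s x) = real_of_int c * coord V w x"
  using indep by (simp add: coord_def lattice_points_def representation_scale)

lemma coord_sum:
  "(\<And>i. i \<in> I \<Longrightarrow> f i \<in> lattice_points V) \<Longrightarrow> coord V w (\<Sum>i\<in>I. f i) = (\<Sum>i\<in>I. coord V w (f i))"
  using indep by (simp add: coord_def lattice_points_def representation_sum real_vec_sum)

lemma coord_0: "coord V w 0 = 0"
  by (simp add: coord_def representation_zero)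

lemma coord_basis: "u \<in> V \<Longrightarrow> coord V w u = (if u = w then 1 else 0)"
  using indep by (auto simp: coord_def representation_basis inj_eq[OF inj_real_vec])

lemma coord_combination:
  assumes "U \<subseteq> V" "w \<in> U"
  shows "coord V w (\<Sum>u\<in>U. c u *s u) = of_int (c w)"
proof -
  have [simp]: "finite U"
    using finite_edges assms(1) finite_subset by blast
  have lat: "u \<in> lattice_points V" if "u \<in> U" for u
    using that assms(1) lattice_points_superset by blast
  then have "coord V w (\<Sum>u\<in>U. c u *s u) = (\<Sum>u\<in>U. coord V w (c u *s u))"
    by (intro coord_sum zvec.subspace_scale[OF subspace_lattice_points])
  also have "\<dots> = (\<Sum>u\<in>U. if u = w then of_int (c u) else 0)"
    using assms(1) lat by (intro sum.cong) (auto simp: coord_scale coord_basis)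
  finally show ?thesis
    using assms(2) by simp
qed

lemma coord_zspan_Diff:
  assumes "x \<in> zvec.span (V - {w})"
  shows "coord V w x = 0"
proof -
  have "zvec.subspace {x \<in> lattice_points V. coord V w x = 0}"
    using subspace_lattice_points[of V]
    by (auto simp: zvec.subspace_def coord_add coord_scale coord_0)
  moreover have "V - {w} \<subseteq> {x \<in> lattice_points V. coord V w x = 0}"
    using lattice_points_superset by (auto simp: coord_basis)
  ultimately show ?thesis
    using assms zvec.span_minimal by blast
qed

lemma sum_coord:
  assumes "x \<in> lattice_points V"
  shows "(\<Sum>v\<in>V. coord V v x *\<^sub>R real_vec v) = real_vec x"
proof -
  have "(\<Sum>v\<in>V. coord V v x *\<^sub>R real_vec v) =
    (\<Sum>b\<in>real_vec ` V. representation (real_vec ` V) (real_vec x) b *\<^sub>R b)"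
    by (subst sum.reindex) (auto simp: coord_def intro: inj_on_subset[OF inj_real_vec])
  also have "\<dots> = real_vec x"
    using assms indep finite_edges
    by (intro sum_representation_eq) (auto simp: lattice_points_def)
  finally show ?thesis .
qed

text \<open>The expansion of \<open>x\<close> loses its \<open>w\<close> term. Combined with
  saturation, a vanishing coordinate yields an integer combination of
  \<open>V - {w}\<close>.\<close>

lemma coord_eq_0D:
  assumes "x \<in> lattice_points V" "coord V w x = 0"
  shows "x \<in> lattice_points (V - {w})"
proof -
  have "real_vec x = (\<Sum>v\<in>V - {w}. coord V v x *\<^sub>R real_vec v)"
    using sum_coord[OF assms(1)] assms(2) finite_edges
    by (cases "w \<in> V") (auto simp: sum.remove)
  also have "\<dots> \<in> span (real_vec ` (V - {w}))"
    by (intro span_sum span_scale span_base) auto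
  finally show ?thesis
    by (simp add: lattice_points_def)
qed

text \<open>Modulo the edge lattice every lattice point can be moved into the half-open
  parallelepiped spanned by \<open>V\<close>, which is bounded.\<close>

lemma finite_coords:
  assumes "w \<in> V"
  shows "finite (coord V w ` lattice_points V \<inter> {0<..1})"
proof -
  \<comment> \<open>Bounds every entry of a combination of \<open>V\<close> with coefficients in the
    unit interval.\<close>
  define M where "M = (\<Sum>v\<in>V. \<Sum>i\<in>UNIV. \<bar>v $ i\<bar>)"
  have "coord V w ` lattice_points V \<inter> {0<..1} \<subseteq>
      insert 1 (coord V w ` {x. \<forall>i. \<bar>x $ i\<bar> \<le> M})"
  proof
    fix t assume "t \<in> coord V w ` lattice_points V \<inter> {0<..1}"
    then obtain x where x: "x \<in> lattice_points V" "t = coord V w x" "0 < t" "t \<le> 1"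
      by auto
    show "t \<in> insert 1 (coord V w ` {x. \<forall>i. \<bar>x $ i\<bar> \<le> M})"
    \<comment> \<open>The value 1 is set apart because removing its integer part would give 0; for
      \<open>0 < t < 1\<close> the floor is 0 and the \<open>w\<close>-coordinate survives.\<close>
    proof (cases "t = 1")
      case False
      define z where "z = (\<Sum>v\<in>V. \<lfloor>coord V v x\<rfloor> *s v)"
      have z: "z \<in> lattice_points V"
        using lattice_points_superset[of V] unfolding z_def
        by (intro zvec.subspace_sum zvec.subspace_scale subspace_lattice_points) auto
      have "\<lfloor>coord V w x\<rfloor> = 0"
        using False x(2-4) by linarith
      then have "coord V w (x - z) = t"
        using x assms z coord_combination[of V w] by (simp add: coord_diff z_def)
      moreover have "\<bar>(x - z) $ i\<bar> \<le> M" for i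
      proof -
        have "real_vec (x - z) = (\<Sum>v\<in>V. frac (coord V v x) *\<^sub>R real_vec v)"
          by (simp add: sum_coord[OF x(1), symmetric] z_def real_vec_sum frac_def
              scaleR_diff_left sum_subtractf)
        then have "real_vec (x - z) $ i = (\<Sum>v\<in>V. frac (coord V v x) * real_of_int (v $ i))"
          by (simp add: real_vec_def)
        then have "\<bar>real_vec (x - z) $ i\<bar> \<le> (\<Sum>v\<in>V. \<bar>frac (coord V v x) * real_of_int (v $ i)\<bar>)"
          by simp
        also have "\<dots> \<le> (\<Sum>v\<in>V. real_of_int (\<Sum>i\<in>UNIV. \<bar>v $ i\<bar>))"
        proof (rule sum_mono)
          fix v
          have "\<bar>frac (coord V v x) * real_of_int (v $ i)\<bar> \<le> 1 * real_of_int \<bar>v $ i\<bar>"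
            unfolding abs_mult of_int_abs
            by (intro mult_right_mono) (auto simp: less_imp_le[OF frac_lt_1])
          also have "\<bar>v $ i\<bar> \<le> (\<Sum>i\<in>UNIV. \<bar>v $ i\<bar>)"
            by (rule member_le_sum) auto
          finally show "\<bar>frac (coord V v x) * real_of_int (v $ i)\<bar> \<le> real_of_int (\<Sum>i\<in>UNIV. \<bar>v $ i\<bar>)"
            by simp
        qed
        finally have "real_of_int \<bar>(x - z) $ i\<bar> \<le> real_of_int M"
          by (simp add: M_def real_vec_def)
        then show ?thesis
          by linarith
      qed
      ultimately show ?thesis
        by blast
    qed auto
  qed
  then show ?thesis
    using finite_bounded_int_vec finite_subset by blast
qed

text \<open>Division with remainder by the smallest positive coordinate, which exists by
  \<open>finite_coords\<close>: the remainder is nonnegative and below the minimum, hence 0.\<close>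

lemma coords_cyclic:
  assumes "w \<in> V"
  obtains y where "y \<in> lattice_points V" "coord V w y > 0"
    "\<And>x. x \<in> lattice_points V \<Longrightarrow> \<exists>m. coord V w x = real_of_int m * coord V w y"
proof -
  define T where "T = coord V w ` lattice_points V \<inter> {0<..1}"
  have fin: "finite T"
    using finite_coords[OF assms] by (simp add: T_def)
  \<comment> \<open>The vector \<open>w\<close> has coordinate 1; the interval is closed at 1 so
    that \<open>T\<close> is nonempty.\<close>
  have "1 \<in> T"
    using assms lattice_points_superset[of V] by (force simp: T_def coord_basis)
  then have "Min T \<in> T"
    using fin by (intro Min_in) auto
  then obtain y where y: "y \<in> lattice_points V" "coord V w y = Min T" "0 < Min T" "Min T \<le> 1"
    unfolding T_def by auto
  have "\<exists>m. coord V w x = real_of_int m * coord V w y" if x: "x \<in> lattice_points V" for x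
  proof -
    define m where "m = \<lfloor>coord V w x / Min T\<rfloor>"
    have lat: "m *s y \<in> lattice_points V" "x - m *s y \<in> lattice_points V"
      using x y(1) by (auto intro: zvec.subspace_scale zvec.subspace_diff subspace_lattice_points)
    have r: "coord V w (x - m *s y) = coord V w x - m * Min T"
      using x y lat by (simp add: coord_diff coord_scale)
    have "of_int m \<le> coord V w x / Min T" "coord V w x / Min T < of_int m + 1"
      unfolding m_def by linarith+
    then have bounds: "0 \<le> coord V w (x - m *s y)" "coord V w (x - m *s y) < Min T"
      using y(3) by (auto simp: r field_simps)
    have "coord V w (x - m *s y) = 0"
    proof (rule ccontr)
      assume "coord V w (x - m *s y) \<noteq> 0"
      then have "coord V w (x - m *s y) \<in> T"
        using bounds lat y(4) by (auto simp: T_def)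
      then show False
        using fin bounds(2) by (meson Min_le not_less)
    qed
    then show ?thesis
      using r y(2) by auto
  qed
  then show ?thesis
    using that y by metis
qed

text \<open>Constructs the last Hermite basis vector \<open>y\<close>. A lattice point of least
  positive \<open>w\<close>-coordinate generates the lattice modulo
  \<open>zvec.span (V - {w})\<close>, and shifting it within that span normalises the coefficients
  of \<open>w\<close>.\<close>

lemma last_basis_vector_exists:
  assumes "w \<in> V" and sat: "lattice_points (V - {w}) \<subseteq> zvec.span (V - {w})"
  obtains y b d where "y \<in> lattice_points V" "d > 0"
    "w = (\<Sum>u\<in>V - {w}. b u *s u) + d *s y"
    "\<And>u. 0 \<le> b u \<and> b u < d"
    "\<And>x. x \<in> lattice_points V \<Longrightarrow> \<exists>m. x - m *s y \<in> zvec.span (V - {w})"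
    "\<And>m. m *s y \<in> zvec.span (V - {w}) \<Longrightarrow> m = 0"
proof -
  let ?W = "V - {w}"
  note sub = zvec.subspace_diff[OF subspace_lattice_points]
    zvec.subspace_scale[OF subspace_lattice_points] zvec.subspace_add[OF subspace_lattice_points]
  obtain x0 where x0: "x0 \<in> lattice_points V" "coord V w x0 > 0"
    "\<And>x. x \<in> lattice_points V \<Longrightarrow> \<exists>m. coord V w x = real_of_int m * coord V w x0"
    using coords_cyclic[OF assms(1)] by metis
  have wV: "w \<in> lattice_points V"
    using assms(1) lattice_points_superset by blast
  obtain d where d: "coord V w w = real_of_int d * coord V w x0"
    using x0(3) wV by blast
  then have "d > 0"
    using x0(2) assms(1) by (simp add: coord_basis) (smt (verit) mult_nonneg_nonneg mult_nonpos_nonneg of_int_0_less_iff)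
  \<comment> \<open>The \<open>w\<close>-coordinate of the difference vanishes, so saturation makes
    its coefficients integers.\<close>
  have "w - d *s x0 \<in> zvec.span ?W"
    using d wV x0(1) by (intro subsetD[OF sat] coord_eq_0D sub) (auto simp: coord_diff coord_scale sub)
  then obtain b where b: "w - d *s x0 = (\<Sum>u\<in>?W. b u *s u)"
    using finite_edges by (auto simp: zvec.span_finite)
  \<comment> \<open>Adding the quotients to \<open>x0\<close> leaves the remainders modulo
    \<open>d\<close> as coefficients of \<open>w\<close>, as the Hermite condition demands.\<close>
  define z where "z = (\<Sum>u\<in>?W. (b u div d) *s u)"
  have zspan: "z \<in> zvec.span ?W"
    unfolding z_def by (intro zvec.span_sum zvec.span_scale zvec.span_base)
  then have zV: "z \<in> lattice_points V"
    using zspan_subset_lattice_points lattice_points_mono[of ?W V] by blast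
  define y where "y = x0 + z"
  have y: "y \<in> lattice_points V" "coord V w y = coord V w x0"
    using x0(1) zV zspan by (auto simp: y_def sub coord_add coord_zspan_Diff)
  have "(\<Sum>u\<in>?W. b u *s u) = (\<Sum>u\<in>?W. (b u mod d) *s u) + d *s z"
    by (simp add: z_def zvec.scale_sum_right zvec.scale_left_distrib[symmetric]
        sum.distrib[symmetric])
  then have "w = (\<Sum>u\<in>?W. (b u mod d) *s u) + d *s y"
    using b by (simp add: y_def zvec.scale_right_distrib algebra_simps)
  moreover have "\<exists>m. x - m *s y \<in> zvec.span ?W" if x: "x \<in> lattice_points V" for x
  proof -
    obtain m where "coord V w x = real_of_int m * coord V w y"
      using x0(3) x y(2) by metis
    then have "x - m *s y \<in> lattice_points ?W"
      using x y(1) by (intro coord_eq_0D sub) (auto simp: coord_diff coord_scale sub)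
    then show ?thesis
      using sat by blast
  qed
  moreover have "m = 0" if "m *s y \<in> zvec.span ?W" for m
    using coord_zspan_Diff[OF that] x0(2) y by (simp add: coord_scale)
  ultimately show ?thesis
    using that[of y d "\<lambda>u. b u mod d"] y(1) \<open>d > 0\<close> by auto
qed

end

section \<open>Passage between numbered edge vectors and their set\<close>

lemma edges_image: "edge \<alpha> ` {1..length (edges \<alpha>)} = set (edges \<alpha>)"
proof -
  have "{1..length (edges \<alpha>)} = Suc ` {..<length (edges \<alpha>)}"
    by (simp add: image_Suc_lessThan)
  then show ?thesis
    by (auto simp: image_image edge_def set_conv_nth)
qed

lemma edge_inj: "distinct (edges \<alpha>) \<Longrightarrow> inj_on (edge \<alpha>) {1..length (edges \<alpha>)}"
  by (auto simp: inj_on_def edge_def nth_eq_iff_index_eq)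

lemma edges_but_last:
  assumes "distinct (edges \<alpha>)" "length (edges \<alpha>) = k" "k \<ge> 1"
  shows "edge \<alpha> ` {1..<k} = set (edges \<alpha>) - {edge \<alpha> k}"
proof -
  have "{1..<k} = {1..k} - {k}"
    by auto
  then show ?thesis
    using inj_on_image_set_diff[OF edge_inj[OF assms(1)], of "{1..k}" "{k}"]
      edges_image[of \<alpha>] assms by simp
qed

lemma sum_edges_but_last:
  assumes "distinct (edges \<alpha>)" "length (edges \<alpha>) = k" "k \<ge> 1"
  shows "(\<Sum>u\<in>set (edges \<alpha>) - {edge \<alpha> k}. f u) = (\<Sum>j\<in>{1..<k}. f (edge \<alpha> j))"
proof -
  have "inj_on (edge \<alpha>) {1..<k}"
    using edge_inj[OF assms(1)] assms(2) by (auto intro: inj_on_subset)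
  then show ?thesis
    by (simp add: edges_but_last[OF assms, symmetric] sum.reindex)
qed

lemma sum_upto_last:
  fixes f :: "nat \<Rightarrow> 'a::comm_monoid_add"
  shows "1 \<le> k \<Longrightarrow> (\<Sum>j = 1..k. f j) = (\<Sum>j\<in>{1..<k}. f j) + f k"
  by (cases k) (auto simp: atLeastLessThanSuc_atLeastAtMost)

section \<open>Existence of a Hermite basis\<close>

text \<open>By saturation all edge vectors but the last can be kept as basis vectors; the last is
  replaced by the \<open>y\<close> of \<open>last_basis_vector_exists\<close>.\<close>

lemma hermite_basis_exists:
  assumes dist: "distinct (edges \<alpha>)" and len: "length (edges \<alpha>) = k" "k \<ge> 1"
    and indep: "independent (real_vec ` set (edges \<alpha>))"
    and sat: "lattice_points (set (edges \<alpha>) - {edge \<alpha> k}) \<subseteq> zvec.span (set (edges \<alpha>) - {edge \<alpha> k})"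
  shows "\<exists>e a. hermite_basis \<alpha> e a"
proof -
  let ?V = "set (edges \<alpha>)" and ?v = "edge \<alpha>"
  let ?W = "?V - {?v k}"
  have vV: "?v j \<in> ?V" if "j \<in> {1..k}" for j
    using that edges_image[of \<alpha>] len by blast
  have kV: "?v k \<in> ?V"
    using vV len(2) by simp
  obtain y b d where y: "y \<in> lattice_points ?V" "d > 0"
    "?v k = (\<Sum>u\<in>?W. b u *s u) + d *s y"
    "\<And>u. 0 \<le> b u \<and> b u < d"
    "\<And>x. x \<in> lattice_points ?V \<Longrightarrow> \<exists>m. x - m *s y \<in> zvec.span ?W"
    "\<And>m. m *s y \<in> zvec.span ?W \<Longrightarrow> m = 0"
    by (rule last_basis_vector_exists[OF indep kV sat]) (rule that, assumption+)
  define e where "e = ?v(k := y)"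
  \<comment> \<open>Identity columns, except for column \<open>k\<close>, which holds the reduced
    coefficients of the last edge vector.\<close>
  define a where "a j i = (if i = k then if j = k then d else b (?v j) else if j = i then 1 else 0)"
    for j i
  have sum_e: "(\<Sum>j = 1..k. c j *s e j) = (\<Sum>j\<in>{1..<k}. c j *s ?v j) + c k *s y" for c
    unfolding sum_upto_last[OF len(2)] by (simp add: e_def)
  have spanW: "(\<Sum>j\<in>{1..<k}. c j *s ?v j) \<in> zvec.span ?W" for c
    unfolding edges_but_last[OF dist len, symmetric]
    by (intro zvec.span_sum zvec.span_scale zvec.span_base) auto
  have gen: "lattice_points ?V = {\<Sum>j = 1..k. c j *s e j | c. True}"
  proof (intro equalityI subsetI)
    fix x assume "x \<in> lattice_points ?V"
    then obtain m where "x - m *s y \<in> zvec.span ?W"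
      using y(5) by blast
    then obtain c where "x - m *s y = (\<Sum>u\<in>?W. c u *s u)"
      by (auto simp: zvec.span_finite)
    then have "x = (\<Sum>j\<in>{1..<k}. c (?v j) *s ?v j) + m *s y"
      by (simp add: sum_edges_but_last[OF dist len] algebra_simps)
    also have "\<dots> = (\<Sum>j = 1..k. (if j = k then m else c (?v j)) *s e j)"
      unfolding sum_e by simp
    finally show "x \<in> {\<Sum>j = 1..k. c j *s e j | c. True}"
      by (intro CollectI exI[of _ "\<lambda>j. if j = k then m else c (?v j)"]) simp
  next
    fix x assume "x \<in> {\<Sum>j = 1..k. c j *s e j | c. True}"
    moreover have "e j \<in> lattice_points ?V" if "j \<in> {1..k}" for j
      using that y(1) vV[OF that] lattice_points_superset by (auto simp: e_def)
    ultimately show "x \<in> lattice_points ?V"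
      by (auto intro!: zvec.subspace_sum zvec.subspace_scale subspace_lattice_points)
  qed
  have lin: "\<forall>j\<in>{1..k}. c j = 0" if c: "(\<Sum>j = 1..k. c j *s e j) = 0" for c
  proof -
    have "c k *s y = - (\<Sum>j\<in>{1..<k}. c j *s ?v j)"
      using c unfolding sum_e by (simp add: eq_neg_iff_add_eq_0 add.commute)
    then have "c k *s y \<in> zvec.span ?W"
      using spanW zvec.span_neg by metis
    then have ck: "c k = 0"
      by (rule y(6))
    \<comment> \<open>Turns coefficients on indices into coefficients on vectors, as
      \<open>coord_combination\<close> sums over a set of vectors.\<close>
    define idx where "idx = inv_into {1..k} ?v"
    have inv: "idx (?v j) = j" if "j \<in> {1..k}" for j
      using edge_inj[OF dist] len that by (simp add: idx_def inv_into_f_f)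
    have "(\<Sum>u\<in>?W. c (idx u) *s u) = (\<Sum>j\<in>{1..<k}. c j *s ?v j)"
      unfolding sum_edges_but_last[OF dist len] by (intro sum.cong) (auto simp: inv)
    also have "\<dots> = 0"
      using c ck unfolding sum_e by simp
    finally have *: "(\<Sum>u\<in>?W. c (idx u) *s u) = 0" .
    have "c j = 0" if "j \<in> {1..<k}" for j
    proof -
      have "?v j \<in> ?W"
        using that edges_but_last[OF dist len] by blast
      then have "coord ?V (?v j) 0 = of_int (c j)"
        using coord_combination[OF indep, of ?W "?v j" "\<lambda>u. c (idx u)"] that
        by (simp add: * inv)
      then show ?thesis
        by (simp add: coord_0[OF indep])
    qed
    then show ?thesis
      using ck by (metis atLeastAtMost_iff atLeastLessThan_iff le_neq_implies_less)
  qed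
  have edge_eq: "?v i = (\<Sum>j = 1..i. a j i *s e j)" if i: "i \<in> {1..k}" for i
  proof (cases "i = k")
    case True
    have "(\<Sum>j = 1..k. a j k *s e j) = (\<Sum>j\<in>{1..<k}. b (?v j) *s ?v j) + d *s y"
      unfolding sum_e by (auto simp: a_def intro!: sum.cong)
    then show ?thesis
      using y(3) True by (simp add: sum_edges_but_last[OF dist len])
  next
    case False
    have "(\<Sum>j = 1..i. a j i *s e j) = (\<Sum>j = 1..i. if j = i then ?v i else 0)"
      using False i by (intro sum.cong) (auto simp: a_def e_def)
    then show ?thesis
      using i by simp
  qed
  have "hermite_basis \<alpha> e a"
    unfolding hermite_basis_def is_int_basis_def Let_def len span_lattice_eq
    using gen lin edge_eq y(2,4) by (auto simp: a_def)
  then show ?thesis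
    by blast
qed

section \<open>The last diagonal entry as an exponent\<close>

text \<open>Characterises \<open>a k k\<close> without reference to the order of the edges. All
  \<open>e j\<close> with \<open>j < k\<close> lie in the edge lattice, so the class of
  \<open>e k\<close> generates the quotient; its order is exactly \<open>a k k\<close>.\<close>

lemma hermite_basis_last_exponent:
  assumes dist: "distinct (edges \<alpha>)" and len: "length (edges \<alpha>) = k" "k \<ge> 1"
    and sat: "lattice_points (set (edges \<alpha>) - {edge \<alpha> k}) \<subseteq> zvec.span (set (edges \<alpha>) - {edge \<alpha> k})"
    and herm: "hermite_basis \<alpha> e a"
  shows "(\<forall>x\<in>span_lattice \<alpha>. m *s x \<in> edge_lattice \<alpha>) \<longleftrightarrow> a k k dvd m"
proof -
  let ?V = "set (edges \<alpha>)" and ?v = "edge \<alpha>"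
  let ?W = "?V - {?v k}"
  have gen: "span_lattice \<alpha> = {\<Sum>j = 1..k. c j *s e j | c. True}"
    and lin: "\<And>c. (\<Sum>j = 1..k. c j *s e j) = 0 \<Longrightarrow> \<forall>j\<in>{1..k}. c j = 0"
    and edge_eq: "\<And>i. i \<in> {1..k} \<Longrightarrow> ?v i = (\<Sum>j = 1..i. a j i *s e j)"
    and pos: "\<And>i. i \<in> {1..k} \<Longrightarrow> a i i > 0"
    using herm by (auto simp: hermite_basis_def is_int_basis_def Let_def len)
  have edge_split: "?v i = (\<Sum>j\<in>{1..<i}. a j i *s e j) + a i i *s e i" if "i \<in> {1..k}" for i
    using edge_eq[OF that] that sum_upto_last[of i] by simp
  have e_eq: "(\<Sum>j = 1..k. (if j = i then m else 0) *s e j) = m *s e i" if "i \<in> {1..k}" for i m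
  proof -
    have "(\<Sum>j = 1..k. (if j = i then m else 0) *s e j) = (\<Sum>j = 1..k. if j = i then m *s e j else 0)"
      by (intro sum.cong) auto
    then show ?thesis
      using that by simp
  qed
  \<comment> \<open>The triangular system is solved over the reals, dividing by
    \<open>a j j\<close>; saturation then restores integrality in \<open>eW\<close>.\<close>
  have real_e: "real_vec (e j) \<in> span (real_vec ` ?W)" if "j \<in> {1..<k}" for j
    using that
  proof (induction j rule: less_induct)
    case (less j)
    have "(\<Sum>i\<in>{1..<j}. real_vec (a i j *s e i)) \<in> span (real_vec ` ?W)"
      using less by (auto intro!: span_sum span_scale)
    moreover have "real_vec (?v j) \<in> span (real_vec ` ?W)"
      using less.prems edges_but_last[OF dist len] by (intro span_base) blast
    ultimately have "real_vec (?v j) - (\<Sum>i\<in>{1..<j}. real_vec (a i j *s e i)) \<in> span (real_vec ` ?W)"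
      by (rule span_diff[rotated])
    also have "real_vec (?v j) - (\<Sum>i\<in>{1..<j}. real_vec (a i j *s e i)) = real_of_int (a j j) *\<^sub>R real_vec (e j)"
      using edge_split[of j] less.prems by (simp add: real_vec_sum)
    finally have "inverse (real_of_int (a j j)) *\<^sub>R (real_of_int (a j j) *\<^sub>R real_vec (e j))
        \<in> span (real_vec ` ?W)"
      by (rule span_scale)
    then show ?case
      using pos[of j] less.prems by simp
  qed
  have eW: "e j \<in> zvec.span ?V" if "j \<in> {1..<k}" for j
    using real_e[OF that] sat zvec.span_mono[of ?W ?V] by (auto simp: lattice_points_def)
  show ?thesis
  proof
    assume "\<forall>x\<in>span_lattice \<alpha>. m *s x \<in> edge_lattice \<alpha>"
    moreover have "e k \<in> span_lattice \<alpha>"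
      unfolding gen using e_eq[of k 1] len(2)
      by (intro CollectI exI[of _ "\<lambda>j. if j = k then 1 else 0"]) simp
    ultimately have mk: "m *s e k \<in> zvec.span ?V"
      by (simp add: edge_lattice_eq)
    \<comment> \<open>A submodule containing the edge lattice: only the last edge vector involves
      \<open>e k\<close>, and does so with coefficient \<open>a k k\<close>.\<close>
    define S where "S = {\<Sum>j = 1..k. c j *s e j | c. a k k dvd c k}"
    have SI: "(\<Sum>j = 1..k. c j *s e j) \<in> S" if "a k k dvd c k" for c
      using that by (auto simp: S_def)
    have "zvec.subspace S"
      unfolding zvec.subspace_def
    proof (intro conjI ballI allI)
      show "0 \<in> S"
        using SI[of "\<lambda>_. 0"] by simp
    next
      fix x y assume "x \<in> S" "y \<in> S"
      then obtain c c' where "x = (\<Sum>j = 1..k. c j *s e j)" "a k k dvd c k"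
        "y = (\<Sum>j = 1..k. c' j *s e j)" "a k k dvd c' k"
        by (auto simp: S_def)
      then show "x + y \<in> S"
        using SI[of "\<lambda>j. c j + c' j"] by (simp add: zvec.scale_left_distrib sum.distrib)
    next
      fix r x assume "x \<in> S"
      then obtain c where "x = (\<Sum>j = 1..k. c j *s e j)" "a k k dvd c k"
        by (auto simp: S_def)
      then show "r *s x \<in> S"
        using SI[of "\<lambda>j. r * c j"] by (simp add: zvec.scale_sum_right)
    qed
    moreover have "?V \<subseteq> S"
    proof
      fix u assume "u \<in> ?V"
      then obtain i where i: "i \<in> {1..k}" "u = ?v i"
        using edges_image[of \<alpha>] len by blast
      have "u = (\<Sum>j = 1..k. (if j \<le> i then a j i else 0) *s e j)"
        unfolding i(2) edge_eq[OF i(1)] using i(1)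
        by (intro sum.mono_neutral_cong_left) auto
      then show "u \<in> S"
        using SI[of "\<lambda>j. if j \<le> i then a j i else 0"] i(1) by auto
    qed
    ultimately have "m *s e k \<in> S"
      using mk zvec.span_minimal by blast
    then obtain c where c: "m *s e k = (\<Sum>j = 1..k. c j *s e j)" "a k k dvd c k"
      by (auto simp: S_def)
    have "(\<Sum>j = 1..k. (c j - (if j = k then m else 0)) *s e j) = 0"
      using c(1) e_eq[of k m] len(2) by (simp add: zvec.scale_left_diff_distrib sum_subtractf)
    then have "c k = m"
      using lin[of "\<lambda>j. c j - (if j = k then m else 0)"] len(2) by auto
    then show "a k k dvd m"
      using c(2) by simp
  next
    assume "a k k dvd m"
    then obtain r where r: "m = r * a k k"
      by (metis dvd_div_mult_self)
    have "a k k *s e k = ?v k - (\<Sum>j\<in>{1..<k}. a j k *s e j)"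
      using edge_split[of k] len(2) by simp
    moreover have "?v k \<in> zvec.span ?V"
      using edges_image[of \<alpha>] len by (intro zvec.span_base) auto
    ultimately have "a k k *s e k \<in> zvec.span ?V"
      by (auto intro!: zvec.span_diff zvec.span_sum zvec.span_scale eW)
    then have "r *s (a k k *s e k) \<in> zvec.span ?V"
      by (rule zvec.span_scale)
    then have mk: "m *s e k \<in> zvec.span ?V"
      by (simp add: r)
    have "m *s x \<in> zvec.span ?V" if x: "x \<in> span_lattice \<alpha>" for x
    proof -
      obtain c where "x = (\<Sum>j = 1..k. c j *s e j)"
        using x gen by auto
      \<comment> \<open>The first sum is in the edge lattice already; the factor \<open>m\<close>
        matters for \<open>e k\<close> alone.\<close>
      then have "m *s x = m *s (\<Sum>j\<in>{1..<k}. c j *s e j) + c k *s (m *s e k)"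
        unfolding sum_upto_last[OF len(2)] by (simp add: zvec.scale_right_distrib mult.commute)
      also have "\<dots> \<in> zvec.span ?V"
        by (intro zvec.span_add zvec.span_scale[OF mk] zvec.span_scale zvec.span_sum eW)
      finally show ?thesis .
    qed
    then show "\<forall>x\<in>span_lattice \<alpha>. m *s x \<in> edge_lattice \<alpha>"
      by (simp add: edge_lattice_eq)
  qed
qed

section \<open>The last integer sine and its invariance\<close>

text \<open>Evaluates the description in \<open>lsin\<close>: the last diagonal entry of any Hermite
  basis has the same multiples as \<open>d\<close>, and positive integers with equal multiples
  coincide.\<close>

lemma lsin_last_eqI:
  assumes "distinct (edges \<alpha>)" "length (edges \<alpha>) = k" "k \<ge> 1"
    and "lattice_points (set (edges \<alpha>) - {edge \<alpha> k}) \<subseteq> zvec.span (set (edges \<alpha>) - {edge \<alpha> k})"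
    and "independent (real_vec ` set (edges \<alpha>))"
    and d: "d > 0" "\<And>m. (\<forall>x\<in>span_lattice \<alpha>. m *s x \<in> edge_lattice \<alpha>) \<longleftrightarrow> d dvd m"
  shows "lsin k \<alpha> = d"
proof -
  have "a k k = d" if "hermite_basis \<alpha> e a" for e a
  proof -
    have "a k k dvd m \<longleftrightarrow> d dvd m" for m
      using hermite_basis_last_exponent[OF assms(1-4) that] d(2) by blast
    moreover have "a k k > 0"
      using that assms(2,3) by (auto simp: hermite_basis_def Let_def)
    ultimately show ?thesis
      using d(1) by (metis dvd_refl zdvd_antisym_nonneg less_imp_le)
  qed
  then show ?thesis
    using hermite_basis_exists[OF assms(1-3) assms(5,4)]
    unfolding lsin_def by (intro the_equality) blast+
qed

theorem proposition3p3:
  fixes \<alpha> :: "'n::finite ordered_cone" and k :: nat and s :: "nat \<Rightarrow> nat"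
  assumes "k \<ge> 2"
    and "rational_cone k \<alpha>"
    and "simple_cone \<alpha>"
    and "\<exists>p \<in> {1..k}. \<exists>q \<in> {1..k}. p \<noteq> q \<and> s = Transposition.transpose p q"
  shows "lsin k \<alpha> = lsin k (cone_transpose s \<alpha>)"
proof -
  let ?\<beta> = "cone_transpose s \<alpha>"
  have k: "length (edges \<alpha>) = k" "k \<ge> 1" and dist: "distinct (edges \<alpha>)"
    and indep: "independent (real_vec ` set (edges \<alpha>))"
    using assms(1,2) by (auto simp: rational_cone_def)
  obtain p q where "p \<in> {1..k}" "q \<in> {1..k}" "s = Transposition.transpose p q"
    using assms(4) by blast
  \<comment> \<open>From here on \<open>s\<close> enters only as a permutation of the
    indices.\<close>
  then have s: "bij_betw s {1..k} {1..k}"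
    by (simp add: bij_betw_transpose_iff)
  have len': "length (edges ?\<beta>) = k"
    by (simp add: cone_transpose_def k)
  have "set (edges ?\<beta>) = edge \<alpha> ` s ` {1..k}"
    by (simp add: cone_transpose_def k image_image atLeastLessThanSuc_atLeastAtMost del: upt_Suc)
  then have set': "set (edges ?\<beta>) = set (edges \<alpha>)"
    using s edges_image[of \<alpha>] k by (simp add: bij_betw_imp_surj_on)
  \<comment> \<open>A list of length \<open>k\<close> with \<open>k\<close> different members has no
    repetition.\<close>
  then have dist': "distinct (edges ?\<beta>)"
    using dist k len' by (metis card_distinct distinct_card)
  have last: "edge \<alpha> k \<in> set (edges \<alpha>)" "edge ?\<beta> k \<in> set (edges \<alpha>)"
    using edges_image[of \<alpha>] edges_image[of ?\<beta>] k len' set' by auto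
  \<comment> \<open>Simplicity of \<alpha> is applied to the facets omitting the last edge vector of
    either ordering.\<close>
  note sat = simple_cone_facetD[OF assms(3) dist last(1)] simple_cone_facetD[OF assms(3) dist last(2)]
  obtain e a where ea: "hermite_basis \<alpha> e a"
    using hermite_basis_exists[OF dist k indep sat(1)] by blast
  then have pos: "a k k > 0"
    using k by (auto simp: hermite_basis_def Let_def)
  note exponent = hermite_basis_last_exponent[OF dist k sat(1) ea]
  have "lsin k \<alpha> = a k k"
    using lsin_last_eqI[OF dist k sat(1) indep pos exponent] .
  \<comment> \<open>Both lattices depend only on the set of edge vectors, so
    \<open>exponent\<close>, proved for \<alpha>, holds for the transpose as well.\<close>
  moreover have "lsin k ?\<beta> = a k k"
    using lsin_last_eqI[OF dist' len' k(2), of "a k k"] sat(2) indep pos exponent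
    by (simp add: set' span_lattice_eq edge_lattice_eq)
  ultimately show ?thesis
    by simp
qed

end
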